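(* Let $\mathfrak{p} = \bigcap_{\sigma\ge 2} \mathcal{P}_\sigma$ denote the set of omnipersistent potential signatures, that is, the tuples that are potential signatures for every genus $\sigma \ge 2$. Then \[ \mathfrak{p} = \bigcap_{\sigma\ge 2} \mathcal{P}_\sigma = \mathcal{P}_2. \]
   Context: Let $\sigma\ge 2$ be an integer. A tuple $(h; m_1,\ldots,m_r)$, where $h\ge 0$ and $r\ge 0$ are integers and $m_1,\ldots,m_r\ge 2$ are integers (written $(h;-)$ when $r=0$), is a potential signature for genus $\sigma$ if there exists a positive integer $N$ such that (1) $m_i \mid N$ for all $1\le i\le r$, and (2) the Riemann-Hurwitz formula holds: \[ \sigma - 1 = N\left( h-1+\frac12\sum_{i=1}^r\left(1-\frac1{m_i}\right)\right). \] No group action realizing the tuple is required to exist. $\mathcal{P}_\sigma$ denotes the set of all potential signatures for genus $\sigma$. *)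

theory Defs
  imports Complex_Main
begin

text \<open>
  The tuple \<open>(h; m\<^sub>1, \<dots>, m\<^sub>r)\<close> is encoded as the pair \<open>(h, [m\<^sub>1, \<dots>, m\<^sub>r])\<close>, so that
  \<open>(h; -)\<close> is \<open>(h, [])\<close>; the periods form an ordered tuple.
\<close>

type_synonym signature = "nat \<times> nat list"

text \<open>
  All arithmetic takes place in \<open>real\<close>, so that \<open>h - 1\<close> equals \<open>-1\<close> for \<open>h = 0\<close>.
  The notion is only meant for genus \<open>\<sigma> \<ge> 2\<close>.
\<close>

definition riemann_hurwitz :: "nat \<Rightarrow> nat \<Rightarrow> signature \<Rightarrow> bool" where
  "riemann_hurwitz \<sigma> N = (\<lambda>(h, ms).
     real \<sigma> - 1 =
       real N * (real h - 1 + 1 / 2 * (\<Sum>i<length ms. 1 - 1 / real (ms ! i))))"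

definition is_potential_signature :: "nat \<Rightarrow> signature \<Rightarrow> bool" where
  "is_potential_signature \<sigma> = (\<lambda>(h, ms).
     (\<forall>m\<in>set ms. 2 \<le> m) \<and>
     (\<exists>N::nat. 0 < N \<and> (\<forall>m\<in>set ms. m dvd N) \<and> riemann_hurwitz \<sigma> N (h, ms)))"

definition potential_signatures :: "nat \<Rightarrow> signature set" where
  "potential_signatures \<sigma> = {s. is_potential_signature \<sigma> s}"

definition omnipersistent_potential_signatures :: "signature set" where
  "omnipersistent_potential_signatures = (\<Inter>\<sigma>\<in>{2..}. potential_signatures \<sigma>)"

end

theory Submission
  imports Defs
begin

text \<open>For genus 2 the left side of Riemann-Hurwitz is 1, and the right side is linear in
  \<open>N\<close>. Multiplying a genus 2 witness \<open>N\<close> by \<sigma> - 1 therefore gives a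
  witness for genus \<sigma> with the same tuple (\<open>riemann_hurwitz_scale\<close>), and the
  periods still divide it. So \<open>potential_signatures 2\<close> lies in every other set; the
  converse inclusion holds because 2 is one of the intersected genera.\<close>

lemma riemann_hurwitz_scale:
  assumes "riemann_hurwitz 2 N s" "\<sigma> \<ge> 1"
  shows "riemann_hurwitz \<sigma> ((\<sigma> - 1) * N) s"
proof (cases s)
  case (Pair h ms)
  define X where "X = real h - 1 + 1 / 2 * (\<Sum>i<length ms. 1 - 1 / real (ms ! i))"
  have "1 = real N * X"
    using assms(1) by (simp add: riemann_hurwitz_def Pair X_def)
  \<comment> \<open>The subtraction inside \<open>real\<close> is truncated on naturals; \<sigma>
    \<ge> 1 makes it agree with the real one.\<close>
  moreover have "real ((\<sigma> - 1) * N) * X = (real \<sigma> - 1) * (real N * X)"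
    using assms(2) by (simp add: of_nat_diff)
  ultimately have "real \<sigma> - 1 = real ((\<sigma> - 1) * N) * X"
    by simp
  then show ?thesis
    by (simp only: riemann_hurwitz_def Pair X_def prod.case)
qed

lemma potential_signatures_2_subset:
  assumes "\<sigma> \<ge> 2"
  shows "potential_signatures 2 \<subseteq> potential_signatures \<sigma>"
proof
  fix s assume s: "s \<in> potential_signatures 2"
  obtain h ms where hms: "s = (h, ms)" by (cases s)
  obtain N where N: "0 < N" "\<forall>m\<in>set ms. m dvd N" "riemann_hurwitz 2 N (h, ms)"
      and ms: "\<forall>m\<in>set ms. 2 \<le> m"
    using s unfolding hms potential_signatures_def is_potential_signature_def by auto
  \<comment> \<open>Positivity of the new witness uses \<sigma> \<ge> 2: for \<sigma> = 1 it would
    be 0.\<close>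
  have "0 < (\<sigma> - 1) * N" "\<forall>m\<in>set ms. m dvd (\<sigma> - 1) * N"
    using N assms by auto
  moreover have "riemann_hurwitz \<sigma> ((\<sigma> - 1) * N) (h, ms)"
    using riemann_hurwitz_scale[OF N(3)] assms by simp
  ultimately show "s \<in> potential_signatures \<sigma>"
    using ms unfolding hms potential_signatures_def is_potential_signature_def by blast
qed

theorem theorem4p1:
  "omnipersistent_potential_signatures = (\<Inter>\<sigma>\<in>{2..}. potential_signatures \<sigma>) \<and>
   (\<Inter>\<sigma>\<in>{2..}. potential_signatures \<sigma>) = potential_signatures 2"
  unfolding omnipersistent_potential_signatures_def
  using potential_signatures_2_subset by auto

end
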